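(* For every positive rational number $m\neq 1$ there are infinitely many proper right spherical triangles (i.e. with one angle equal to $\pi/2$) all of whose sides and angles are rational and whose area $A$ satisfies $\frac{\sin A}{1+\cos A}=m$.
   Context: A spherical triangle lies on the unit sphere and has sides that are arcs of great circles; it is proper if its three side lengths and its three angles all lie in $(0,\pi)$. Its area is $A=\alpha+\beta+\gamma-\pi$, where $\alpha,\beta,\gamma$ are its angles. An angle, length or area $x$ is called rational if $\sin x,\cos x\in\mathbb{Q}$, equivalently $e^{ix}\in\mathbb{Q}(i)$, equivalently $\frac{\sin x}{1+\cos x}\in\mathbb{Q}$. *)

theory Defs
  imports "HOL-Analysis.Analysis"
begin

text \<open>
  A spherical triangle is given by its ordered triple of vertices on the unit sphere. Its sides are
  the minor great-circle arcs between the vertices, so lengths and angles take values in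
  \<open>[0, \<pi>]\<close>. This covers all proper triangles: sides shorter than \<open>\<pi>\<close> are determined by
  their endpoints, and angles smaller than \<open>\<pi>\<close> by the two sides enclosing them.
\<close>

type_synonym point3 = "real ^ 3"
type_synonym triangle = "point3 \<times> point3 \<times> point3"

definition arc_length :: "point3 \<Rightarrow> point3 \<Rightarrow> real" where
  "arc_length P Q = arccos (P \<bullet> Q)"

text \<open>
  The component of \<open>Q\<close> orthogonal to \<open>P\<close> is tangent at \<open>P\<close> to the minor arc
  from \<open>P\<close> to \<open>Q\<close>. It vanishes iff \<open>Q = P\<close> or \<open>Q = - P\<close>.
\<close>

definition arc_tangent :: "point3 \<Rightarrow> point3 \<Rightarrow> point3" where
  "arc_tangent P Q = Q - (P \<bullet> Q) *\<^sub>R P"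

definition sph_angle :: "point3 \<Rightarrow> point3 \<Rightarrow> point3 \<Rightarrow> real" where
  "sph_angle P Q R =
     arccos ((arc_tangent P Q \<bullet> arc_tangent P R) / (norm (arc_tangent P Q) * norm (arc_tangent P R)))"

fun vertices :: "triangle \<Rightarrow> point3 set" where
  "vertices (A, B, C) = {A, B, C}"

fun sides :: "triangle \<Rightarrow> real set" where
  "sides (A, B, C) = {arc_length B C, arc_length C A, arc_length A B}"

fun angles :: "triangle \<Rightarrow> real set" where
  "angles (A, B, C) = {sph_angle A B C, sph_angle B C A, sph_angle C A B}"

fun area :: "triangle \<Rightarrow> real" where
  "area (A, B, C) = sph_angle A B C + sph_angle B C A + sph_angle C A B - pi"

definition spherical_triangle :: "triangle \<Rightarrow> bool" where
  "spherical_triangle T \<longleftrightarrow> vertices T \<subseteq> sphere 0 1"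

definition proper :: "triangle \<Rightarrow> bool" where
  "proper T \<longleftrightarrow> spherical_triangle T \<and> sides T \<subseteq> {0<..<pi} \<and> angles T \<subseteq> {0<..<pi}"

definition right :: "triangle \<Rightarrow> bool" where
  "right T \<longleftrightarrow> pi / 2 \<in> angles T"

definition trig_rational :: "real \<Rightarrow> bool" where
  "trig_rational x \<longleftrightarrow> sin x \<in> \<rat> \<and> cos x \<in> \<rat>"

text \<open>
  Triangles are counted up to isometries of the sphere (including reflections) and relabelling of
  the vertices. Counting individual triangles would be trivial, as any triangle has infinitely
  many rotated copies.
\<close>

definition congruence :: "(triangle \<times> triangle) set" where
  "congruence = {(S, T). \<exists>f. orthogonal_transformation f \<and> f ` vertices S = vertices T}"

lemma equiv_congruence: "equiv UNIV congruence"
proof (rule equivI)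
  show "refl congruence"
    by (force simp: refl_on_def congruence_def intro: exI[of _ "\<lambda>x. x"])
  show "sym congruence"
  proof (rule symI)
    fix S T assume "(S, T) \<in> congruence"
    then obtain f where f: "orthogonal_transformation f" "f ` vertices S = vertices T"
      by (auto simp: congruence_def)
    have "inv f ` vertices T = vertices S"
      using f by (metis image_inv_f_f orthogonal_transformation_inj)
    then show "(T, S) \<in> congruence"
      using orthogonal_transformation_inv[OF f(1)] by (auto simp: congruence_def)
  qed
  show "trans congruence"
  proof (rule transI)
    fix S T U assume "(S, T) \<in> congruence" "(T, U) \<in> congruence"
    then obtain f g where "orthogonal_transformation f" "f ` vertices S = vertices T"
      "orthogonal_transformation g" "g ` vertices T = vertices U"
      by (auto simp: congruence_def)
    then have "orthogonal_transformation (g \<circ> f)" "(g \<circ> f) ` vertices S = vertices U"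
      by (simp_all only: orthogonal_transformation_compose image_comp[symmetric])
    then show "(S, U) \<in> congruence"
      unfolding congruence_def by blast
  qed
qed auto

end

theory Submission
  imports Defs
begin

text \<open>
  Let \<open>a\<close>, \<open>b\<close> be the legs, \<open>c\<close> the hypotenuse, and \<open>p\<close>, \<open>q\<close>, \<open>t\<close> the tangents of their halves.  The
  area condition is \<open>p q = m\<close>, and then \<open>cos c = cos a cos b\<close> becomes \<open>p\<^sup>2 + q\<^sup>2 = \<kappa> t\<^sup>2\<close> with
  \<open>\<kappa> = 1 + m\<^sup>2\<close>.  Hence rational \<open>p\<close>, \<open>q\<close> belong to a rational \<open>t\<close> iff \<open>\<kappa> t\<^sup>2 + 2 m = (p + q)\<^sup>2\<close> and
  \<open>\<kappa> t\<^sup>2 - 2 m = (p - q)\<^sup>2\<close> are rational squares; the angles are then rational automatically.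

  With \<open>t = 1 / (\<kappa> s)\<close> and \<open>n = 2 m \<kappa>\<close> this is the genus one curve \<open>\<kappa> c\<^sup>2 = 1 + n s\<^sup>2\<close>,
  \<open>\<kappa> d\<^sup>2 = 1 - n s\<^sup>2\<close>, a torsor of the elliptic curve with \<open>\<kappa> = 1\<close>; the group law is the addition
  theorem of the Jacobi functions.  The torsor has the point \<open>P\<close> with \<open>t = 1\<close>, whose double lies on the
  elliptic curve.  Repeated doubling of \<open>2 P\<close> strictly increases the 2-adic valuation of \<open>s\<close>, which
  yields infinitely many rational points \<open>Q\<close>, and the points \<open>P + Q\<close> are the required ones.  The
  assumption \<open>m \<noteq> 1\<close> ensures that \<open>2 P\<close> is not trivial.
\<close>

section \<open>Rational numbers of 2-adic valuation zero\<close>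

definition odd_rat :: "rat \<Rightarrow> bool" where
  "odd_rat x \<longleftrightarrow> (\<exists>a b :: int. odd a \<and> odd b \<and> x = of_int a / of_int b)"

lemma odd_ratI: "odd a \<Longrightarrow> odd b \<Longrightarrow> x = of_int a / of_int b \<Longrightarrow> odd_rat x"
  unfolding odd_rat_def by blast

lemma odd_rat_1: "odd_rat 1"
  by (rule odd_ratI[of 1 1]) auto

lemma odd_rat_mult:
  assumes "odd_rat x" "odd_rat y"
  shows "odd_rat (x * y)"
proof -
  obtain a b c d :: int where "odd a" "odd b" "x = of_int a / of_int b"
    "odd c" "odd d" "y = of_int c / of_int d"
    using assms unfolding odd_rat_def by blast
  then show ?thesis
    by (intro odd_ratI[of "a * c" "b * d"]) auto
qed

lemma odd_rat_inverse:
  assumes "odd_rat x"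
  shows "odd_rat (inverse x)"
proof -
  obtain a b :: int where "odd a" "odd b" "x = of_int a / of_int b"
    using assms unfolding odd_rat_def by blast
  then show ?thesis
    by (intro odd_ratI[of b a]) auto
qed

text \<open>The denominator of the doubling formula has this form.\<close>

lemma odd_rat_two_minus_power2:
  assumes "odd_rat x"
  shows "odd_rat (2 - x\<^sup>2)"
proof -
  obtain a b :: int where ab: "odd a" "odd b" "x = of_int a / of_int b"
    using assms unfolding odd_rat_def by blast
  then have "b \<noteq> 0" by auto
  then have "2 - x\<^sup>2 = of_int (2 * b\<^sup>2 - a\<^sup>2) / of_int (b\<^sup>2)"
    unfolding ab(3) by (simp add: power_divide diff_divide_distrib)
  with ab show ?thesis
    by (intro odd_ratI[of "2 * b\<^sup>2 - a\<^sup>2" "b\<^sup>2"]) simp_all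
qed

text \<open>In lowest terms both denominators agree, so
  \<open>a\<^sup>2 + c\<^sup>2 = 2 * b\<^sup>2\<close>. If \<open>a\<close>, \<open>c\<close> were
  even, so would be \<open>b\<close>; hence they are odd, and modulo 4 this makes \<open>b\<close>
  odd.\<close>

lemma odd_rat_if_sum_squares_eq_2:
  assumes "x\<^sup>2 + y\<^sup>2 = 2"
  shows "odd_rat x \<and> odd_rat y"
proof -
  obtain a b where x: "x = of_int a / of_int b" "b > 0" "coprime a b"
    by (cases x) (simp add: Fract_of_int_quotient)
  obtain c d where y: "y = of_int c / of_int d" "d > 0" "coprime c d"
    by (cases y) (simp add: Fract_of_int_quotient)
  have "(of_int (a\<^sup>2 * d\<^sup>2 + c\<^sup>2 * b\<^sup>2) :: rat) = of_int (2 * b\<^sup>2 * d\<^sup>2)"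
    using assms x y by (simp add: field_simps)
  then have eq: "a\<^sup>2 * d\<^sup>2 + c\<^sup>2 * b\<^sup>2 = 2 * b\<^sup>2 * d\<^sup>2"
    by linarith
  have "a\<^sup>2 * d\<^sup>2 = b\<^sup>2 * (2 * d\<^sup>2 - c\<^sup>2)" "c\<^sup>2 * b\<^sup>2 = d\<^sup>2 * (2 * b\<^sup>2 - a\<^sup>2)"
    using eq by (simp_all add: algebra_simps)
  then have "b\<^sup>2 dvd a\<^sup>2 * d\<^sup>2" "d\<^sup>2 dvd c\<^sup>2 * b\<^sup>2"
    by simp_all
  moreover have "coprime (b\<^sup>2) (a\<^sup>2)" "coprime (d\<^sup>2) (c\<^sup>2)"
    using x(3) y(3) by (simp_all add: coprime_commute)
  ultimately have "b\<^sup>2 dvd d\<^sup>2" "d\<^sup>2 dvd b\<^sup>2"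
    by (simp_all add: coprime_dvd_mult_right_iff)
  then have "b\<^sup>2 = d\<^sup>2"
    using zdvd_antisym_nonneg by simp
  then have "b = d"
    using x(2) y(2) by (simp add: power2_eq_iff)
  with eq have "(a\<^sup>2 + c\<^sup>2) * b\<^sup>2 = (2 * b\<^sup>2) * b\<^sup>2"
    by (simp add: algebra_simps)
  then have sum: "a\<^sup>2 + c\<^sup>2 = 2 * b\<^sup>2"
    using x(2) by simp
  then have "even (a\<^sup>2 + c\<^sup>2)"
    by simp
  then have ac: "odd a \<longleftrightarrow> odd c"
    by simp
  have "odd a"
  proof
    assume "even a"
    with ac have "even c" by simp
    with \<open>even a\<close> obtain k l where "a = 2 * k" "c = 2 * l" by (elim evenE)
    with sum have "b\<^sup>2 = 2 * (k\<^sup>2 + l\<^sup>2)" by (simp add: power2_eq_square)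
    then have "even (b\<^sup>2)" by simp
    then have "even b" by simp
    with \<open>even a\<close> x(3) show False
      using coprime_common_divisor[of a b 2] by simp
  qed
  with ac have "odd c"
    by simp
  from \<open>odd a\<close> obtain k where "a = 2 * k + 1"
    by (rule oddE)
  moreover from \<open>odd c\<close> obtain l where "c = 2 * l + 1"
    by (rule oddE)
  ultimately have "b\<^sup>2 = 2 * (k\<^sup>2 + k + l\<^sup>2 + l) + 1"
    using sum by (simp add: power2_eq_square algebra_simps)
  then have "odd (b\<^sup>2)"
    by simp
  then have "odd b"
    by simp
  show ?thesis
    using odd_ratI[OF \<open>odd a\<close> \<open>odd b\<close> x(1)] odd_ratI[OF \<open>odd c\<close> \<open>odd b\<close>] y(1) \<open>b = d\<close>
    by simp
qed

text \<open>Half of the uniqueness of the 2-adic valuation; exchanging the sides gives the other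
  half.\<close>

lemma two_power_odd_rat_le:
  assumes "2 ^ j * x = 2 ^ k * y" "odd_rat x" "odd_rat y"
  shows "k \<le> j"
proof (rule ccontr)
  assume "\<not> k \<le> j"
  then have "j < k" by simp
  then have "(2::rat) ^ k = 2 ^ j * 2 ^ (k - j)"
    by (simp flip: power_add)
  with assms(1) have xy: "x = 2 ^ (k - j) * y"
    by simp
  obtain a b c d :: int where ab: "odd a" "odd b" "x = of_int a / of_int b"
    "odd c" "odd d" "y = of_int c / of_int d"
    using assms unfolding odd_rat_def by blast
  then have "b \<noteq> 0" "d \<noteq> 0" by auto
  with xy ab have "(of_int (a * d) :: rat) = of_int (2 ^ (k - j) * c * b)"
    by (simp add: field_simps)
  then have "a * d = 2 ^ (k - j) * c * b"
    by linarith
  with ab \<open>j < k\<close> show False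
    by (metis even_mult_iff even_numeral even_power zero_less_diff)
qed

section \<open>Rational points on the genus one curves\<close>

text \<open>
  For \<open>\<kappa> = 1\<close> the triples are the values of the Jacobi functions sn, cn, dn, up to normalisation,
  for parameter \<open>-1\<close>.  For general \<open>\<kappa>\<close>, cn and dn are divided by \<open>sqrt \<kappa>\<close>.
\<close>

definition jacobi :: "'a::linordered_field \<Rightarrow> 'a \<Rightarrow> 'a \<Rightarrow> 'a \<Rightarrow> 'a \<Rightarrow> bool" where
  "jacobi \<kappa> n s c d \<longleftrightarrow> \<kappa> * c\<^sup>2 = 1 + n * s\<^sup>2 \<and> \<kappa> * d\<^sup>2 = 1 - n * s\<^sup>2"

text \<open>Adds a point of the elliptic curve to a point of the torsor. As \<open>\<Delta>\<close>
  is positive, the formula has no exceptional cases.\<close>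

lemma jacobi_add:
  fixes \<kappa> n :: "'a::linordered_field"
  assumes "jacobi \<kappa> n s c d" "jacobi 1 n \<sigma> \<gamma> \<delta>"
  defines "\<Delta> \<equiv> 1 + (n * s * \<sigma>)\<^sup>2"
  shows "jacobi \<kappa> n ((s * \<gamma> * \<delta> + \<kappa> * \<sigma> * c * d) / \<Delta>)
    ((c * \<gamma> + n * s * \<sigma> * d * \<delta>) / \<Delta>) ((d * \<delta> - n * s * \<sigma> * c * \<gamma>) / \<Delta>)"
proof -
  have "\<Delta> > 0"
    unfolding \<Delta>_def by (simp add: add_pos_nonneg)
  moreover have "\<kappa> * (c * \<gamma> + n * s * \<sigma> * d * \<delta>)\<^sup>2 = \<Delta>\<^sup>2 + n * (s * \<gamma> * \<delta> + \<kappa> * \<sigma> * c * d)\<^sup>2"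
    "\<kappa> * (d * \<delta> - n * s * \<sigma> * c * \<gamma>)\<^sup>2 = \<Delta>\<^sup>2 - n * (s * \<gamma> * \<delta> + \<kappa> * \<sigma> * c * d)\<^sup>2"
    using assms(1,2) unfolding jacobi_def \<Delta>_def by algebra+
  ultimately show ?thesis
    unfolding jacobi_def by (simp add: power_divide field_simps)
qed

text \<open>Since \<open>\<gamma>\<^sup>2 + \<delta>\<^sup>2 = 2\<close>, both coordinates are
  2-adic units, and so is \<open>\<Delta>\<close>; doubling thus raises the valuation of
  \<open>\<sigma>\<close> by exactly one.\<close>

lemma jacobi_double:
  assumes "jacobi 1 n \<sigma> \<gamma> \<delta>"
  shows "\<exists>r \<gamma>' \<delta>'. odd_rat r \<and> jacobi 1 n (2 * \<sigma> * r) \<gamma>' \<delta>'"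
proof -
  have sq: "\<gamma>\<^sup>2 = 1 + n * \<sigma>\<^sup>2" "\<delta>\<^sup>2 = 1 - n * \<sigma>\<^sup>2"
    using assms by (simp_all add: jacobi_def)
  then have "odd_rat \<gamma>" "odd_rat \<delta>"
    using odd_rat_if_sum_squares_eq_2[of \<gamma> \<delta>] by auto
  then have odd: "odd_rat (\<gamma> * \<delta>)"
    by (rule odd_rat_mult)
  have \<Delta>: "1 + (n * \<sigma> * \<sigma>)\<^sup>2 = 2 - (\<gamma> * \<delta>)\<^sup>2"
    using sq by algebra
  let ?r = "(\<gamma> * \<delta>) * inverse (2 - (\<gamma> * \<delta>)\<^sup>2)"
  have "odd_rat ?r"
    by (rule odd_rat_mult[OF odd odd_rat_inverse[OF odd_rat_two_minus_power2[OF odd]]])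
  moreover have "(\<sigma> * \<gamma> * \<delta> + 1 * \<sigma> * \<gamma> * \<delta>) / (1 + (n * \<sigma> * \<sigma>)\<^sup>2) = 2 * \<sigma> * ?r"
    unfolding \<Delta> by (simp add: divide_inverse algebra_simps)
  moreover note jacobi_add[OF assms assms]
  ultimately show ?thesis
    by (intro exI conjI) (assumption, simp only:)
qed

lemma infinite_jacobi_1:
  assumes "jacobi 1 n \<sigma> \<gamma> \<delta>" "\<sigma> \<noteq> 0"
  shows "infinite {s :: rat. \<exists>c d. jacobi 1 n s c d}"
proof -
  have "\<exists>r c d. odd_rat r \<and> jacobi 1 n (2 ^ k * \<sigma> * r) c d" for k
  proof (induction k)
    case 0
    then show ?case
      using assms(1) odd_rat_1 by (metis mult.right_neutral mult_1 power_0)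
  next
    case (Suc k)
    then obtain r c d where r: "odd_rat r" "jacobi 1 n (2 ^ k * \<sigma> * r) c d"
      by blast
    then obtain r' c' d' where "odd_rat r'" "jacobi 1 n (2 * (2 ^ k * \<sigma> * r) * r') c' d'"
      using jacobi_double by blast
    then have "odd_rat (r * r')" "jacobi 1 n (2 ^ Suc k * \<sigma> * (r * r')) c' d'"
      using r(1) by (simp_all add: odd_rat_mult mult.assoc)
    then show ?case by blast
  qed
  then obtain r where r: "\<And>k. odd_rat (r k)" "\<And>k. \<exists>c d. jacobi 1 n (2 ^ k * \<sigma> * r k) c d"
    by metis
  have "inj (\<lambda>k. 2 ^ k * \<sigma> * r k)"
  proof (rule injI)
    fix j k
    assume "2 ^ j * \<sigma> * r j = 2 ^ k * \<sigma> * r k"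
    then have "2 ^ j * r j = 2 ^ k * r k"
      using assms(2) by simp
    then show "j = k"
      using two_power_odd_rat_le[of j "r j" k "r k"] two_power_odd_rat_le[of k "r k" j "r j"] r(1)
      by simp
  qed
  then have "infinite (range (\<lambda>k. 2 ^ k * \<sigma> * r k))"
    by (simp add: range_inj_infinite)
  then show ?thesis
    by (rule infinite_super[rotated]) (use r(2) in auto)
qed

text \<open>Translation by the given point carries the elliptic curve into the torsor, and each
  first coordinate arises from only finitely many \<open>\<sigma>\<close>.\<close>

lemma infinite_jacobi_transfer:
  fixes \<kappa> n :: "'a::linordered_field"
  assumes P: "jacobi \<kappa> n s c d" and nz: "\<kappa> \<noteq> 0" "s \<noteq> 0" "c \<noteq> 0" "d \<noteq> 0"
    and inf: "infinite {\<sigma>. \<exists>\<gamma> \<delta>. jacobi 1 n \<sigma> \<gamma> \<delta>}"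
  shows "infinite {s. \<exists>c d. jacobi \<kappa> n s c d}"
proof
  assume fin: "finite {s. \<exists>c d. jacobi \<kappa> n s c d}"
  \<comment> \<open>If \<open>z\<close> is the first coordinate of the sum of the given point and a point over \<open>\<sigma>\<close>, then
    \<open>\<sigma> \<in> B z\<close>: square the addition formula to eliminate \<open>\<gamma>\<close> and \<open>\<delta>\<close>.\<close>
  define B where "B z = {\<sigma>. (z * (1 + (n * s * \<sigma>)\<^sup>2) - \<kappa> * \<sigma> * c * d)\<^sup>2 = s\<^sup>2 * (1 - n\<^sup>2 * \<sigma> ^ 4)}" for z
  have "finite (B z)" for z
  proof -
    let ?q = "[:z, - (\<kappa> * c * d), z * (n * s)\<^sup>2:]"
    let ?p = "?q\<^sup>2 - [:s\<^sup>2, 0, 0, 0, - (s\<^sup>2 * n\<^sup>2):]"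
    \<comment> \<open>If the constant coefficient vanishes, then \<open>z\<close> is
      \<open>s\<close> or \<open>- s\<close>, hence nonzero, and the linear coefficient
      survives.\<close>
    have "coeff ?p 0 = z\<^sup>2 - s\<^sup>2" "coeff ?p 1 = - 2 * z * (\<kappa> * c * d)"
      by (simp_all add: power2_eq_square)
    then have "?p \<noteq> 0"
      using nz by (metis coeff_0 diff_eq_eq add_0 mult_eq_0_iff neg_equal_0_iff_equal power2_eq_iff
          power_zero_numeral zero_neq_numeral)
    moreover have "B z = {\<sigma>. poly ?p \<sigma> = 0}"
      unfolding B_def by (auto simp: algebra_simps power2_eq_square power4_eq_xxxx)
    ultimately show ?thesis
      by (metis poly_roots_finite)
  qed
  moreover have "{\<sigma>. \<exists>\<gamma> \<delta>. jacobi 1 n \<sigma> \<gamma> \<delta>} \<subseteq> (\<Union>z\<in>{s. \<exists>c d. jacobi \<kappa> n s c d}. B z)"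
  proof clarify
    fix \<sigma> \<gamma> \<delta>
    assume Q: "jacobi 1 n \<sigma> \<gamma> \<delta>"
    let ?z = "(s * \<gamma> * \<delta> + \<kappa> * \<sigma> * c * d) / (1 + (n * s * \<sigma>)\<^sup>2)"
    have "1 + (n * s * \<sigma>)\<^sup>2 > 0"
      by (simp add: add_pos_nonneg)
    then have "?z * (1 + (n * s * \<sigma>)\<^sup>2) - \<kappa> * \<sigma> * c * d = s * \<gamma> * \<delta>"
      by simp
    moreover have "(s * \<gamma> * \<delta>)\<^sup>2 = s\<^sup>2 * (1 - n\<^sup>2 * \<sigma> ^ 4)"
      using Q unfolding jacobi_def by algebra
    ultimately have "\<sigma> \<in> B ?z"
      unfolding B_def by simp
    then show "\<sigma> \<in> (\<Union>z\<in>{s. \<exists>c d. jacobi \<kappa> n s c d}. B z)"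
      using jacobi_add[OF P Q] by blast
  qed
  ultimately show False
    using inf fin by (meson finite_UN_I finite_subset)
qed

lemma infinite_half_tangents:
  fixes m :: rat
  assumes m: "m > 0" "m \<noteq> 1"
  shows "infinite {t. t > 0 \<and> (\<exists>u v. (1 + m\<^sup>2) * t\<^sup>2 + 2 * m = u\<^sup>2 \<and> (1 + m\<^sup>2) * t\<^sup>2 - 2 * m = v\<^sup>2)}"
    (is "infinite ?T")
proof
  assume fin: "finite ?T"
  define \<kappa> where "\<kappa> = 1 + m\<^sup>2"
  define n where "n = 2 * m * \<kappa>"
  define D where "D = \<kappa>\<^sup>2 + 4 * m\<^sup>2"
  have \<kappa>: "\<kappa> > 0"
    unfolding \<kappa>_def by (simp add: add_pos_nonneg)
  then have D: "D > 0"
    unfolding D_def by (simp add: add_pos_nonneg)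
  have m2: "1 - m\<^sup>2 \<noteq> 0"
    using m by (auto simp: power2_eq_1_iff)
  \<comment> \<open>The solution \<open>t = 1\<close>, \<open>u = 1 + m\<close>,
    \<open>v = 1 - m\<close>, with \<open>c = u * s\<close> and \<open>d = v * s\<close>.\<close>
  have P: "jacobi \<kappa> n (1 / \<kappa>) ((1 + m) / \<kappa>) ((1 - m) / \<kappa>)"
    using \<kappa> unfolding jacobi_def n_def
    by (simp add: power_divide field_simps) (simp add: \<kappa>_def power2_eq_square algebra_simps)
  \<comment> \<open>This is twice the point in \<open>P\<close>.\<close>
  have "jacobi 1 n (2 * (1 - m\<^sup>2) / D) (((1 + m)\<^sup>2 * \<kappa> + 2 * m * (1 - m)\<^sup>2) / D)
    (((1 - m)\<^sup>2 * \<kappa> - 2 * m * (1 + m)\<^sup>2) / D)"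
  proof -
    have "((1 + m)\<^sup>2 * \<kappa> + 2 * m * (1 - m)\<^sup>2)\<^sup>2 = D\<^sup>2 + n * (2 * (1 - m\<^sup>2))\<^sup>2"
      "((1 - m)\<^sup>2 * \<kappa> - 2 * m * (1 + m)\<^sup>2)\<^sup>2 = D\<^sup>2 - n * (2 * (1 - m\<^sup>2))\<^sup>2"
      unfolding D_def n_def \<kappa>_def by algebra+
    then show ?thesis
      using D unfolding jacobi_def by (simp add: power_divide field_simps)
  qed
  then have "infinite {s. \<exists>c d. jacobi 1 n s c d}"
    by (rule infinite_jacobi_1) (use D m2 in simp)
  \<comment> \<open>Here \<open>m \<noteq> 1\<close> is used again: it makes the last coordinate of
    \<open>P\<close> nonzero.\<close>
  then have "infinite {s. \<exists>c d. jacobi \<kappa> n s c d}"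
    using infinite_jacobi_transfer[OF P] \<kappa> m by simp
  \<comment> \<open>\<open>t\<close> is positive but \<open>s\<close> has either sign, hence two
    images; \<open>s = 0\<close> would be \<open>t\<close> at infinity.\<close>
  moreover have "{s. \<exists>c d. jacobi \<kappa> n s c d} \<subseteq>
    {0} \<union> (\<lambda>t. 1 / (\<kappa> * t)) ` ?T \<union> (\<lambda>t. - 1 / (\<kappa> * t)) ` ?T"
  proof clarify
    fix s c d
    assume J: "jacobi \<kappa> n s c d"
      and notin: "s \<notin> (\<lambda>t. - 1 / (\<kappa> * t)) ` ?T" "s \<notin> (\<lambda>t. 1 / (\<kappa> * t)) ` ?T" "s \<notin> {}"
    show "s = 0"
    proof (rule ccontr)
      assume s: "s \<noteq> 0"
      let ?t = "1 / (\<kappa> * \<bar>s\<bar>)"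
      have t2: "\<kappa> * ?t\<^sup>2 = 1 / (\<kappa> * s\<^sup>2)"
        using s \<kappa> by (simp add: power_divide power_mult_distrib field_simps power2_eq_square)
      have sq: "c\<^sup>2 = (1 + n * s\<^sup>2) / \<kappa>" "d\<^sup>2 = (1 - n * s\<^sup>2) / \<kappa>"
        using J \<kappa> unfolding jacobi_def by (simp_all add: field_simps)
      have "\<kappa> * ?t\<^sup>2 + 2 * m = (c / s)\<^sup>2" "\<kappa> * ?t\<^sup>2 - 2 * m = (d / s)\<^sup>2"
        unfolding t2 power_divide[of _ s] sq using s \<kappa>
        by (simp_all add: n_def add_divide_distrib diff_divide_distrib)
      then have "?t \<in> ?T"
        using s \<kappa> unfolding \<kappa>_def by auto
      moreover have "s = 1 / (\<kappa> * ?t) \<or> s = - 1 / (\<kappa> * ?t)"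
        using s \<kappa> by (auto simp: abs_if)
      ultimately show False
        using notin by blast
    qed
  qed
  ultimately show False
    using fin by (meson finite.emptyI finite.insertI finite_UnI finite_imageI finite_subset)
qed

section \<open>Right triangles with given legs\<close>

text \<open>The right angle is at the north pole, and the legs run along perpendicular meridians,
  \<open>b\<close> to the first vertex and \<open>a\<close> to the second.\<close>

definition legs_triangle :: "real \<Rightarrow> real \<Rightarrow> triangle" where
  "legs_triangle a b = (vector [sin b, 0, cos b], vector [0, sin a, cos a], vector [0, 0, 1])"

lemma inner_vector3:
  "(vector [x, y, z] :: real ^ 3) \<bullet> vector [x', y', z'] = x * x' + y * y' + z * z'"
  by (simp add: inner_vec_def sum_3)

lemma norm_vector3: "norm (vector [x, y, z] :: real ^ 3) = sqrt (x\<^sup>2 + y\<^sup>2 + z\<^sup>2)"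
  by (simp add: norm_eq_sqrt_inner inner_vector3 power2_eq_square)

text \<open>The spherical law of cosines: for unit vectors the tangents have squared norms
  \<open>1 - (P \<bullet> Q)\<^sup>2\<close> and \<open>1 - (P \<bullet> R)\<^sup>2\<close>.\<close>

lemma sph_angle_inner:
  assumes "norm P = 1" "norm Q = 1" "norm R = 1"
  shows "sph_angle P Q R = arccos ((Q \<bullet> R - (P \<bullet> Q) * (P \<bullet> R)) /
    (sqrt (1 - (P \<bullet> Q)\<^sup>2) * sqrt (1 - (P \<bullet> R)\<^sup>2)))"
proof -
  have "arc_tangent P X \<bullet> arc_tangent P Y = X \<bullet> Y - (P \<bullet> X) * (P \<bullet> Y)" for X Y
    using assms(1) unfolding arc_tangent_def
    by (simp add: inner_diff_left inner_diff_right norm_eq_1 inner_commute)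
  then show ?thesis
    using assms(2,3) unfolding sph_angle_def
    by (simp add: norm_eq_sqrt_inner[of "arc_tangent _ _"] norm_eq_1 power2_eq_square)
qed

lemma arccos_if_sin_pos:
  assumes "x\<^sup>2 + y\<^sup>2 = 1" "y > 0"
  shows "arccos x \<in> {0<..<pi}" "cos (arccos x) = x" "sin (arccos x) = y"
proof -
  have "x\<^sup>2 < 1"
    using assms by (smt (verit) zero_less_power)
  then have "\<bar>x\<bar> < 1"
    by (simp add: abs_square_less_1)
  then have x: "- 1 < x" "x < 1" by auto
  then show "arccos x \<in> {0<..<pi}"
    using arccos_lt_bounded by simp
  show "cos (arccos x) = x"
    using x by simp
  have "1 - x\<^sup>2 = y\<^sup>2"
    using assms(1) by simp
  then show "sin (arccos x) = y"
    using x assms(2) by (simp add: sin_arccos)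
qed

text \<open>The ratio on the left is \<open>tan (area / 2)\<close>, so this is the classical \<open>tan (E/2) = tan (a/2) tan (b/2)\<close>.\<close>

lemma legs_triangle:
  fixes a b S :: real
  assumes ab: "a \<in> {0<..<pi}" "b \<in> {0<..<pi}"
    and S: "S > 0" "(cos a * cos b)\<^sup>2 + S\<^sup>2 = 1"
    and rat: "trig_rational a" "trig_rational b" "S \<in> \<rat>"
  defines "T \<equiv> legs_triangle a b"
  shows "proper T" "right T" "\<forall>s\<in>sides T. trig_rational s" "\<forall>\<theta>\<in>angles T. trig_rational \<theta>"
    "sin (area T) / (1 + cos (area T)) = sin a / (1 + cos a) * (sin b / (1 + cos b))"
proof -
  define A B C where ABC: "A = (vector [sin b, 0, cos b] :: point3)"
    "B = (vector [0, sin a, cos a] :: point3)" "C = (vector [0, 0, 1] :: point3)"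
  have T: "T = (A, B, C)"
    unfolding T_def legs_triangle_def ABC ..
  have norms: "norm A = 1" "norm B = 1" "norm C = 1"
    unfolding ABC by (simp_all add: norm_vector3)
  have inners: "A \<bullet> B = cos a * cos b" "B \<bullet> C = cos a" "C \<bullet> A = cos b"
    unfolding ABC by (simp_all add: inner_vector3)
  have inners': "B \<bullet> A = cos a * cos b" "C \<bullet> B = cos a" "A \<bullet> C = cos b"
    using inners by (simp_all add: inner_commute)
  have pos: "sin a > 0" "sin b > 0"
    using ab by (simp_all add: sin_gt_zero)
  have sq: "1 - (cos a)\<^sup>2 = (sin a)\<^sup>2" "1 - (cos b)\<^sup>2 = (sin b)\<^sup>2" "1 - (cos a * cos b)\<^sup>2 = S\<^sup>2"
    using S by (simp_all add: sin_squared_eq)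
  \<comment> \<open>Cosine and sine of the angle at \<open>A\<close>, then of the angle at
    \<open>B\<close>, by Napier's rules; \<open>S\<close> is the sine of the hypotenuse.\<close>
  define x y z w where xyzw: "x = cos a * sin b / S" "y = sin a / S" "z = cos b * sin a / S" "w = sin b / S"
  have xyzw_pos: "y > 0" "w > 0"
    unfolding xyzw using pos S by simp_all
  have sides: "arc_length B C = a" "arc_length C A = b" "arc_length A B = arccos (cos a * cos b)"
    unfolding arc_length_def inners using ab by (simp_all add: arccos_cos)
  have angC: "sph_angle C A B = pi / 2"
    unfolding sph_angle_inner[OF norms(3,1,2)] inners inners' by simp
  have "cos a - cos b * (cos a * cos b) = cos a * (1 - (cos b)\<^sup>2)"
    "cos b - cos a * (cos a * cos b) = cos b * (1 - (cos a)\<^sup>2)"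
    by (simp_all add: power2_eq_square algebra_simps)
  then have nums: "cos a - cos a * cos b * cos b = cos a * (sin b)\<^sup>2"
    "cos b - cos a * (cos a * cos b) = cos b * (sin a)\<^sup>2"
    unfolding sq by (simp_all add: mult_ac)
  have angA: "sph_angle A B C = arccos x"
    unfolding sph_angle_inner[OF norms(1,2,3)] inners inners' nums sq xyzw
    using pos S by (simp add: power2_eq_square)
  have angB: "sph_angle B C A = arccos z"
    unfolding sph_angle_inner[OF norms(2,3,1)] inners inners' nums sq xyzw
    using pos S by (simp add: power2_eq_square)
  have "(cos a * sin b)\<^sup>2 + (sin a)\<^sup>2 = S\<^sup>2" "(cos b * sin a)\<^sup>2 + (sin b)\<^sup>2 = S\<^sup>2"
    using sq by algebra+
  then have xy: "x\<^sup>2 + y\<^sup>2 = 1" and zw: "z\<^sup>2 + w\<^sup>2 = 1"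
    unfolding xyzw using S by (simp_all add: power_divide flip: add_divide_distrib)
  note arcs = arccos_if_sin_pos[OF S(2,1)] arccos_if_sin_pos[OF xy xyzw_pos(1)]
    arccos_if_sin_pos[OF zw xyzw_pos(2)]
  show "proper T"
    unfolding proper_def spherical_triangle_def T
    using norms ab arcs by (simp add: sides angA angB angC)
  show "right T"
    unfolding right_def T by (simp add: angC)
  have "x \<in> \<rat>" "y \<in> \<rat>" "z \<in> \<rat>" "w \<in> \<rat>" "cos a * cos b \<in> \<rat>"
    using rat unfolding xyzw trig_rational_def by simp_all
  then show "\<forall>s\<in>sides T. trig_rational s" "\<forall>\<theta>\<in>angles T. trig_rational \<theta>"
    using rat unfolding T by (simp_all add: sides angA angB angC trig_rational_def arcs)
  define E where "E = area T"
  have E: "E = (arccos x + arccos z) - pi / 2"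
    unfolding E_def T by (simp add: angA angB angC)
  have sinE: "sin E = y * w - x * z" and cosE: "cos E = y * z + x * w"
    unfolding E by (simp_all add: sin_diff cos_diff sin_add cos_add arcs)
  have cospos: "1 + cos a > 0" "1 + cos b > 0"
    using pos cos_ge_minus_one[of a] cos_ge_minus_one[of b] sq
    by (smt (verit) power2_minus one_power2 zero_less_power)+
  \<comment> \<open>This factor is common to \<open>S\<^sup>2 * sin E\<close> and
    \<open>S\<^sup>2 * (1 + cos E)\<close> and cancels in the quotient.\<close>
  have c1: "1 - cos a * cos b > 0"
    using S by (smt (verit) one_power2 zero_less_power power_mono)
  have "S\<^sup>2 * sin E = sin a * sin b * (1 - cos a * cos b)"
    unfolding sinE xyzw using S(1) by (simp add: field_simps power2_eq_square)
  moreover have "S\<^sup>2 * (1 + cos E) = (1 + cos a) * (1 + cos b) * (1 - cos a * cos b)"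
  proof -
    have "S\<^sup>2 * (1 + cos E) = S\<^sup>2 + (sin a)\<^sup>2 * cos b + cos a * (sin b)\<^sup>2"
      unfolding cosE xyzw using S(1) by (simp add: field_simps power2_eq_square)
    also have "\<dots> = (1 + cos a) * (1 + cos b) * (1 - cos a * cos b)"
      unfolding sq[symmetric] by algebra
    finally show ?thesis .
  qed
  ultimately have "(S\<^sup>2 * sin E) / (S\<^sup>2 * (1 + cos E)) = sin a * sin b / ((1 + cos a) * (1 + cos b))"
    using c1 by simp
  then show "sin (area T) / (1 + cos (area T)) = sin a / (1 + cos a) * (sin b / (1 + cos b))"
    using S(1) unfolding E_def by simp
qed

lemma ex_arc_half_tangent:
  fixes p :: real
  assumes "p > 0"
  shows "\<exists>a\<in>{0<..<pi}. cos a = (1 - p\<^sup>2) / (1 + p\<^sup>2) \<and> sin a = 2 * p / (1 + p\<^sup>2)"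
proof -
  have "1 + p\<^sup>2 > 0"
    by (simp add: add_pos_nonneg)
  moreover have "(1 - p\<^sup>2)\<^sup>2 + (2 * p)\<^sup>2 = (1 + p\<^sup>2)\<^sup>2"
    by algebra
  ultimately have "((1 - p\<^sup>2) / (1 + p\<^sup>2))\<^sup>2 + (2 * p / (1 + p\<^sup>2))\<^sup>2 = 1"
    by (simp only: power_divide flip: add_divide_distrib) simp
  moreover have "2 * p / (1 + p\<^sup>2) > 0"
    using assms \<open>1 + p\<^sup>2 > 0\<close> by simp
  ultimately show ?thesis
    using arccos_if_sin_pos by blast
qed

section \<open>Counting congruence classes\<close>

text \<open>The inner products between vertices are a congruence invariant, and include \<open>cos c\<close>.\<close>

definition gram :: "triangle \<Rightarrow> real set" where
  "gram T = (\<lambda>(P, Q). P \<bullet> Q) ` (vertices T \<times> vertices T)"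

lemma finite_gram: "finite (gram T)"
  by (cases T) (simp add: gram_def)

lemma gram_congruent:
  assumes "(S, T) \<in> congruence"
  shows "gram S = gram T"
proof -
  obtain f where f: "orthogonal_transformation f" "f ` vertices S = vertices T"
    using assms by (auto simp: congruence_def)
  have "gram T = (\<lambda>(P, Q). f P \<bullet> f Q) ` (vertices S \<times> vertices S)"
    unfolding gram_def f(2)[symmetric] by force
  then show ?thesis
    using f(1) by (simp add: gram_def orthogonal_transformation_def)
qed

text \<open>All triangles of a class share one finite \<open>gram\<close> set, so finitely many
  classes would yield finitely many inner products.\<close>

lemma infinite_quotient_congruence:
  assumes "infinite (\<Union>T\<in>\<T>. gram T)"
  shows "infinite (\<T> // congruence)"
proof
  assume fin: "finite (\<T> // congruence)"
  have gram_class: "(\<Union>S\<in>congruence `` {T}. gram S) = gram T" for T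
    using gram_congruent equiv_class_self[OF equiv_congruence, of T] by blast
  have "(\<Union>T\<in>\<T>. gram T) = (\<Union>X\<in>\<T> // congruence. \<Union>S\<in>X. gram S)"
    unfolding quotient_def using gram_class by simp
  moreover have "finite (\<Union>S\<in>X. gram S)" if "X \<in> \<T> // congruence" for X
    using that gram_class finite_gram by (auto elim!: quotientE)
  ultimately show False
    using assms fin by auto
qed

text \<open>The last conjunct records the cosine of the hypotenuse, by which the triangles are told
  apart.\<close>

lemma right_triangle_of_half_tangent:
  fixes m t u v :: rat
  assumes m: "m > 0" and t: "t > 0"
    and uv: "(1 + m\<^sup>2) * t\<^sup>2 + 2 * m = u\<^sup>2" "(1 + m\<^sup>2) * t\<^sup>2 - 2 * m = v\<^sup>2"
  shows "\<exists>T. (proper T \<and> right T \<and>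
         (\<forall>s \<in> sides T. trig_rational s) \<and> (\<forall>\<theta> \<in> angles T. trig_rational \<theta>) \<and>
         sin (area T) / (1 + cos (area T)) = of_rat m) \<and>
         of_rat ((1 - t\<^sup>2) / (1 + t\<^sup>2)) \<in> gram T"
proof -
  \<comment> \<open>Solves \<open>u = p + q\<close>, \<open>v = p - q\<close> for the half tangents
    of the legs; absolute values absorb the free signs of \<open>u\<close> and
    \<open>v\<close>.\<close>
  define p q where pq: "p = \<bar>u + v\<bar> / 2" "q = \<bar>u - v\<bar> / 2"
  have "u\<^sup>2 - v\<^sup>2 = 4 * m"
    using uv by simp
  then have uv4: "(u + v) * (u - v) = 4 * m"
    by (simp add: power2_eq_square algebra_simps)
  have pqm: "p * q = m"
    unfolding pq using uv4 m by (simp flip: abs_mult)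
  have pos: "p > 0" "q > 0"
    using pqm m unfolding pq by (auto simp: zero_less_mult_iff)
  have "p\<^sup>2 + q\<^sup>2 = (u\<^sup>2 + v\<^sup>2) / 2"
    unfolding pq by (simp add: power_divide field_simps power2_eq_square)
  then have sum: "p\<^sup>2 + q\<^sup>2 = (1 + m\<^sup>2) * t\<^sup>2"
    using uv by simp
  define P Q \<tau> :: real where PQ: "P = of_rat p" "Q = of_rat q" "\<tau> = of_rat t"
  have PQpos: "P > 0" "Q > 0" "\<tau> > 0"
    unfolding PQ using pos t by simp_all
  have PQm: "P * Q = of_rat m"
    unfolding PQ pqm[symmetric] by (simp add: of_rat_mult)
  have "of_rat (p\<^sup>2 + q\<^sup>2) = (of_rat ((1 + m\<^sup>2) * t\<^sup>2) :: real)"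
    using sum by simp
  then have PQsum: "P\<^sup>2 + Q\<^sup>2 = (1 + (P * Q)\<^sup>2) * \<tau>\<^sup>2"
    unfolding PQ PQm[unfolded PQ] by (simp add: of_rat_add of_rat_mult of_rat_power)
  have nz: "1 + P\<^sup>2 > 0" "1 + Q\<^sup>2 > 0" "1 + \<tau>\<^sup>2 > 0" "1 + (P * Q)\<^sup>2 > 0"
    by (simp_all add: add_pos_nonneg)
  obtain a where a: "a \<in> {0<..<pi}" "cos a = (1 - P\<^sup>2) / (1 + P\<^sup>2)" "sin a = 2 * P / (1 + P\<^sup>2)"
    using ex_arc_half_tangent[OF PQpos(1)] by blast
  obtain b where b: "b \<in> {0<..<pi}" "cos b = (1 - Q\<^sup>2) / (1 + Q\<^sup>2)" "sin b = 2 * Q / (1 + Q\<^sup>2)"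
    using ex_arc_half_tangent[OF PQpos(2)] by blast
  obtain c where c: "c \<in> {0<..<pi}" "cos c = (1 - \<tau>\<^sup>2) / (1 + \<tau>\<^sup>2)" "sin c = 2 * \<tau> / (1 + \<tau>\<^sup>2)"
    using ex_arc_half_tangent[OF PQpos(3)] by blast
  \<comment> \<open>The quotient of these identities is
    \<open>cos a * cos b = cos c\<close>.\<close>
  have prods: "(1 - P\<^sup>2) * (1 - Q\<^sup>2) = (1 + (P * Q)\<^sup>2) * (1 - \<tau>\<^sup>2)"
    "(1 + P\<^sup>2) * (1 + Q\<^sup>2) = (1 + (P * Q)\<^sup>2) * (1 + \<tau>\<^sup>2)"
    using PQsum by algebra+
  have cosc: "cos a * cos b = cos c"
    unfolding a b c times_divide_times_eq prods using nz by simp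
  have rats: "trig_rational a" "trig_rational b" "sin c \<in> \<rat>"
    unfolding trig_rational_def a b c PQ by simp_all
  have "sin c > 0" "(cos a * cos b)\<^sup>2 + (sin c)\<^sup>2 = 1"
    using c(1) by (simp_all add: cosc sin_gt_zero)
  note T = legs_triangle[OF a(1) b(1) this rats]
  have "1 + cos a = 2 / (1 + P\<^sup>2)" "1 + cos b = 2 / (1 + Q\<^sup>2)"
    unfolding a b using nz by (simp_all add: field_simps)
  then have "sin a / (1 + cos a) * (sin b / (1 + cos b)) = of_rat m"
    unfolding a(3) b(3) using nz PQm by simp
  moreover have "of_rat ((1 - t\<^sup>2) / (1 + t\<^sup>2)) = cos a * cos b"
    unfolding cosc c PQ by (simp add: of_rat_divide of_rat_add of_rat_diff of_rat_power)
  then have "of_rat ((1 - t\<^sup>2) / (1 + t\<^sup>2)) \<in> gram (legs_triangle a b)"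
    unfolding gram_def legs_triangle_def by (simp add: image_iff inner_vector3)
  ultimately show ?thesis
    using T by (intro exI[of _ "legs_triangle a b"]) simp
qed

theorem theorem2:
  fixes m :: rat
  assumes "m > 0" and "m \<noteq> 1"
  shows "infinite
    ({T. proper T \<and> right T \<and>
         (\<forall>s \<in> sides T. trig_rational s) \<and> (\<forall>\<theta> \<in> angles T. trig_rational \<theta>) \<and>
         sin (area T) / (1 + cos (area T)) = of_rat m} // congruence)"
    (is "infinite (?\<T> // congruence)")
proof (rule infinite_quotient_congruence)
  let ?H = "{t. t > 0 \<and> (\<exists>u v. (1 + m\<^sup>2) * t\<^sup>2 + 2 * m = u\<^sup>2 \<and> (1 + m\<^sup>2) * t\<^sup>2 - 2 * m = v\<^sup>2)}"
  let ?f = "\<lambda>t :: rat. of_rat ((1 - t\<^sup>2) / (1 + t\<^sup>2)) :: real"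
  \<comment> \<open>\<open>?f t\<close> is the cosine of the hypotenuse; positivity in
    \<open>?H\<close> makes \<open>t\<close> recoverable from \<open>t\<^sup>2\<close>.\<close>
  have "inj_on ?f ?H"
  proof (rule inj_onI)
    fix s t
    assume st: "s \<in> ?H" "t \<in> ?H" and "?f s = ?f t"
    then have "(1 - s\<^sup>2) / (1 + s\<^sup>2) = (1 - t\<^sup>2) / (1 + t\<^sup>2)"
      by simp
    moreover have "1 + s\<^sup>2 > 0" "1 + t\<^sup>2 > 0"
      by (simp_all add: add_pos_nonneg)
    ultimately have "(1 - s\<^sup>2) * (1 + t\<^sup>2) = (1 - t\<^sup>2) * (1 + s\<^sup>2)"
      by (simp add: frac_eq_eq)
    then have "s\<^sup>2 = t\<^sup>2"
      by (simp add: algebra_simps)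
    with st show "s = t"
      by (simp add: power2_eq_iff_nonneg)
  qed
  then have "infinite (?f ` ?H)"
    using infinite_half_tangents[OF assms] by (simp add: finite_image_iff)
  moreover have "?f ` ?H \<subseteq> (\<Union>T\<in>?\<T>. gram T)"
    using right_triangle_of_half_tangent[OF assms(1)] by fastforce
  ultimately show "infinite (\<Union>T\<in>?\<T>. gram T)"
    by (rule infinite_super[rotated])
qed

end
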